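(* Let $\mathcal{A}$ be a unital $*$-subalgebra of $\mathbb{M}_n$ and let $\mathcal{E}:\mathbb{M}_n\to\mathcal{A}$ be a conditional expectation channel. Let $\mathcal{S}\subseteq\mathbb{C}^n$ be a nonempty set of pure states (unit vectors) and let $\rho_0\in\mathbb{M}_n$ be a density operator. Then $[\mathcal{S},\mathcal{E},\rho_0]$ is a private quantum channel if and only if $\rho_0\in\mathcal{A}$ and every $|v\rangle\in\mathcal{S}$ is a trace vector of $\mathcal{A}$ with respect to $\rho_0$.
   Context: $\mathbb{M}_n$ is the algebra of complex $n\times n$ matrices. A unital $*$-subalgebra of $\mathbb{M}_n$ is a subalgebra closed under adjoints and containing the identity matrix. A density operator is a positive semidefinite operator of trace $1$. A quantum channel is a linear, completely positive, trace preserving map. Conditional expectation channel: a linear map $\mathcal{E}:\mathbb{M}_n\to\mathcal{A}$ onto a unital $*$-subalgebra $\mathcal{A}\subseteq\mathbb{M}_n$ is a conditional expectation if (i) $\mathcal{E}(b)=b$ for all $b\in\mathcal{A}$; (ii) $\mathcal{E}(b_1ab_2)=b_1\mathcal{E}(a)b_2$ for all $b_1,b_2\in\mathcal{A}$ and $a\in\mathbb{M}_n$; (iii) $a\ge0$ implies $\mathcal{E}(a)\ge0$. It is a conditional expectation channel if it is in addition a quantum channel, in particular trace preserving. Private quantum channel: for a set $\mathcal{S}$ of pure states (unit vectors) in $\mathbb{C}^n$, a channel $\mathcal{E}$ on $\mathbb{M}_n$ (here regarded as a map $\mathbb{M}_n\to\mathbb{M}_n$) and a density operator $\rho_0$, the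 triple $[\mathcal{S},\mathcal{E},\rho_0]$ is a private quantum channel if $\mathcal{E}(|\phi\rangle\langle\phi|)=\rho_0$ for every $|\phi\rangle\in\mathcal{S}$. Trace vector with respect to $\rho_0$: for a $*$-subalgebra $\mathcal{A}\subseteq\mathbb{M}_n$ and a density operator $\rho_0$, a vector $|v\rangle\in\mathbb{C}^n$ is a trace vector of $\mathcal{A}$ with respect to $\rho_0$ if $\langle v|a|v\rangle=\operatorname{Tr}(\rho_0a)$ for all $a\in\mathcal{A}$. *)

theory Defs
  imports "HOL-Analysis.Analysis"
begin

text \<open>The algebra of complex matrices of size \<open>n\<close> is \<open>complex ^ 'n ^ 'n\<close> with \<open>n = CARD('n)\<close>.
  The library's \<open>scaleR\<close> on this type only gives the real vector space structure, hence the
  complex scalar multiplication below. Likewise the library's \<open>inner\<close> on \<open>complex ^ 'n\<close> is the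
  real part of \<open>cdot\<close>; the induced norms agree, so unit vectors are given by \<open>norm\<close>.\<close>

type_synonym 'n cmat = "complex ^ 'n ^ 'n"

definition mscale :: "complex \<Rightarrow> 'n::finite cmat \<Rightarrow> 'n cmat" where
  "mscale c a = (\<chi> i j. c * a $ i $ j)"

lemma vector_space_mscale: "vector_space mscale"
  by unfold_locales (simp_all add: mscale_def vec_eq_iff algebra_simps)

definition madjoint :: "'n::finite cmat \<Rightarrow> 'n cmat" where
  "madjoint a = (\<chi> i j. cnj (a $ j $ i))"

definition cdot :: "complex ^ 'n::finite \<Rightarrow> complex ^ 'n \<Rightarrow> complex" where
  "cdot u v = (\<Sum>i\<in>UNIV. cnj (u $ i) * v $ i)"

definition ketbra :: "complex ^ 'n::finite \<Rightarrow> complex ^ 'n \<Rightarrow> 'n cmat" where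
  "ketbra u v = (\<chi> i j. u $ i * cnj (v $ j))"

definition psd :: "'n::finite cmat \<Rightarrow> bool" where
  "psd a \<longleftrightarrow> (\<forall>v. cdot v (a *v v) \<in> \<real>\<^sub>\<ge>\<^sub>0)"

definition density_operator :: "'n::finite cmat \<Rightarrow> bool" where
  "density_operator \<rho> \<longleftrightarrow> psd \<rho> \<and> trace \<rho> = 1"

definition star_subalgebra :: "'n::finite cmat set \<Rightarrow> bool" where
  "star_subalgebra A \<longleftrightarrow> module.subspace mscale A \<and>
     (\<forall>a\<in>A. \<forall>b\<in>A. a ** b \<in> A) \<and> (\<forall>a\<in>A. madjoint a \<in> A)"

definition unital_star_subalgebra :: "'n::finite cmat set \<Rightarrow> bool" where
  "unital_star_subalgebra A \<longleftrightarrow> star_subalgebra A \<and> mat 1 \<in> A"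

text \<open>Positivity of the \<open>k \<times> k\<close> block matrix with entries \<open>x i j\<close> (\<open>i, j < k\<close>), as an operator
  on the direct sum of \<open>k\<close> copies of \<open>complex ^ 'n\<close>, whose elements are the families
  \<open>v 0, \<dots>, v (k - 1)\<close>. This identifies block matrices with the tensor product of the
  \<open>k \<times> k\<close> matrices and \<open>'n cmat\<close>.\<close>

definition block_psd :: "nat \<Rightarrow> (nat \<Rightarrow> nat \<Rightarrow> 'n::finite cmat) \<Rightarrow> bool" where
  "block_psd k x \<longleftrightarrow>
     (\<forall>v :: nat \<Rightarrow> complex ^ 'n. (\<Sum>i<k. \<Sum>j<k. cdot (v i) (x i j *v v j)) \<in> \<real>\<^sub>\<ge>\<^sub>0)"

definition completely_positive :: "('n::finite cmat \<Rightarrow> 'n cmat) \<Rightarrow> bool" where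
  "completely_positive E \<longleftrightarrow> (\<forall>k x. block_psd k x \<longrightarrow> block_psd k (\<lambda>i j. E (x i j)))"

definition quantum_channel :: "('n::finite cmat \<Rightarrow> 'n cmat) \<Rightarrow> bool" where
  "quantum_channel E \<longleftrightarrow>
     Vector_Spaces.linear mscale mscale E \<and> completely_positive E \<and> (\<forall>a. trace (E a) = trace a)"

definition conditional_expectation :: "'n::finite cmat set \<Rightarrow> ('n cmat \<Rightarrow> 'n cmat) \<Rightarrow> bool" where
  "conditional_expectation A E \<longleftrightarrow>
     unital_star_subalgebra A \<and> Vector_Spaces.linear mscale mscale E \<and> range E = A \<and>
     (\<forall>b\<in>A. E b = b) \<and>
     (\<forall>b1\<in>A. \<forall>b2\<in>A. \<forall>a. E (b1 ** a ** b2) = b1 ** E a ** b2) \<and>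
     (\<forall>a. psd a \<longrightarrow> psd (E a))"

definition conditional_expectation_channel ::
    "'n::finite cmat set \<Rightarrow> ('n cmat \<Rightarrow> 'n cmat) \<Rightarrow> bool" where
  "conditional_expectation_channel A E \<longleftrightarrow> conditional_expectation A E \<and> quantum_channel E"

definition private_quantum_channel ::
    "(complex ^ 'n::finite) set \<Rightarrow> ('n cmat \<Rightarrow> 'n cmat) \<Rightarrow> 'n cmat \<Rightarrow> bool" where
  "private_quantum_channel S E \<rho> \<longleftrightarrow>
     (\<forall>\<phi>\<in>S. norm \<phi> = 1) \<and> quantum_channel E \<and> density_operator \<rho> \<and>
     (\<forall>\<phi>\<in>S. E (ketbra \<phi> \<phi>) = \<rho>)"

definition trace_vector ::
    "'n::finite cmat set \<Rightarrow> 'n cmat \<Rightarrow> complex ^ 'n \<Rightarrow> bool" where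
  "trace_vector A \<rho> v \<longleftrightarrow> star_subalgebra A \<and> density_operator \<rho> \<and>
     (\<forall>a\<in>A. cdot v (a *v v) = trace (\<rho> ** a))"

end

theory Submission
  imports Defs
begin

text \<open>Since \<open>E\<close> preserves the trace and is an \<open>A\<close>-bimodule map, \<open>Tr (E x a) = Tr (x a)\<close> for
  \<open>a \<in> A\<close>: it is the orthogonal projection onto \<open>A\<close> for the Hilbert-Schmidt inner product.
  With \<open>x = |v\<rangle>\<langle>v|\<close> the right-hand side is \<open>\<langle>v|a|v\<rangle>\<close>, so \<open>v\<close> is a trace vector with respect to
  \<open>\<rho>\<close> iff \<open>E x\<close> and \<open>\<rho>\<close> have the same pairing with every element of \<open>A\<close>. By nondegeneracy on the
  \<open>*\<close>-closed subspace \<open>A\<close>, this means \<open>E x = \<rho>\<close> as soon as \<open>\<rho> \<in> A\<close>.\<close>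

lemma trace_ketbra_mult: "trace (ketbra v v ** a) = cdot v (a *v v)"
proof -
  have "trace (ketbra v v ** a) = (\<Sum>i\<in>UNIV. \<Sum>k\<in>UNIV. v $ i * cnj (v $ k) * a $ k $ i)"
    by (simp add: trace_def ketbra_def matrix_matrix_mult_def)
  also have "\<dots> = (\<Sum>k\<in>UNIV. \<Sum>i\<in>UNIV. v $ i * cnj (v $ k) * a $ k $ i)"
    by (rule sum.swap)
  also have "\<dots> = cdot v (a *v v)"
    by (simp add: cdot_def matrix_vector_mult_def sum_distrib_left mult_ac)
  finally show ?thesis .
qed

text \<open>The squared Hilbert-Schmidt norm; its definiteness makes the trace pairing
  nondegenerate.\<close>

lemma trace_mult_madjoint:
  "trace (a ** madjoint a) = of_real (\<Sum>i\<in>UNIV. \<Sum>j\<in>UNIV. (cmod (a $ i $ j))\<^sup>2)"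
  by (simp add: trace_def madjoint_def matrix_matrix_mult_def complex_norm_square
      flip: of_real_power)

lemma trace_mult_madjoint_eq_0_iff: "trace (a ** madjoint a) = 0 \<longleftrightarrow> a = 0"
  unfolding trace_mult_madjoint of_real_eq_0_iff
  by (simp add: sum_nonneg_eq_0_iff sum_nonneg vec_eq_iff)

lemma star_subalgebra_diff:
  assumes "star_subalgebra A" "a \<in> A" "b \<in> A"
  shows "a - b \<in> A"
proof -
  interpret vector_space mscale by (rule vector_space_mscale)
  show ?thesis
    using assms by (auto simp: star_subalgebra_def intro: subspace_diff)
qed

lemma star_subalgebra_eqI:
  assumes A: "star_subalgebra A" and ab: "a \<in> A" "b \<in> A"
    and eq: "\<And>c. c \<in> A \<Longrightarrow> trace (a ** c) = trace (b ** c)"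
  shows "a = b"
proof -
  \<comment> \<open>The test element \<open>c\<close> that turns the pairing with
    \<open>a - b\<close> into its squared norm.\<close>
  have "madjoint (a - b) \<in> A"
    using A star_subalgebra_diff[OF A ab] by (auto simp: star_subalgebra_def)
  from eq[OF this] have "trace ((a - b) ** madjoint (a - b)) = 0"
    by (simp add: trace_def matrix_matrix_mult_def left_diff_distrib sum_subtractf)
  then show ?thesis
    by (simp add: trace_mult_madjoint_eq_0_iff)
qed

lemma conditional_expectation_channel_trace_mult:
  assumes "conditional_expectation_channel A E" "a \<in> A"
  shows "trace (E x ** a) = trace (x ** a)"
proof -
  \<comment> \<open>Unitality allows \<open>mat 1\<close> as left factor in the bimodule
    law.\<close>
  have "E (mat 1 ** x ** a) = mat 1 ** E x ** a"
    using assms unfolding conditional_expectation_channel_def conditional_expectation_def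
      unital_star_subalgebra_def by blast
  then have "E x ** a = E (x ** a)" by simp
  then show ?thesis
    using assms by (simp add: conditional_expectation_channel_def quantum_channel_def)
qed

theorem theorem5p1:
  fixes A :: "(complex ^ 'n::finite ^ 'n) set"
    and E :: "complex ^ 'n ^ 'n \<Rightarrow> complex ^ 'n ^ 'n"
    and S :: "(complex ^ 'n) set"
    and \<rho>\<^sub>0 :: "complex ^ 'n ^ 'n"
  assumes "unital_star_subalgebra A"
    and "conditional_expectation_channel A E"
    and "S \<noteq> {}"
    and "\<forall>v\<in>S. norm v = 1"
    and "density_operator \<rho>\<^sub>0"
  shows "private_quantum_channel S E \<rho>\<^sub>0 \<longleftrightarrow> \<rho>\<^sub>0 \<in> A \<and> (\<forall>v\<in>S. trace_vector A \<rho>\<^sub>0 v)"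
proof -
  have A: "star_subalgebra A"
    using assms(1) by (simp add: unital_star_subalgebra_def)
  have range: "E x \<in> A" for x
    using assms(2) by (auto simp: conditional_expectation_channel_def conditional_expectation_def)
  have pairing: "cdot v (a *v v) = trace (E (ketbra v v) ** a)" if "a \<in> A" for a v
    using conditional_expectation_channel_trace_mult[OF assms(2) that]
    by (simp add: trace_ketbra_mult)
  have "E (ketbra v v) = \<rho>\<^sub>0 \<longleftrightarrow> \<rho>\<^sub>0 \<in> A \<and> trace_vector A \<rho>\<^sub>0 v" for v
    using A assms(5) range pairing star_subalgebra_eqI[OF A range]
    by (metis trace_vector_def)
  moreover have "quantum_channel E"
    using assms(2) by (simp add: conditional_expectation_channel_def)
  ultimately show ?thesis
    \<comment> \<open>A vector of the nonempty \<open>S\<close> yields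
      \<open>\<rho>\<^sub>0 \<in> A\<close> in the forward direction.\<close>
    using assms(3-5) by (auto simp: private_quantum_channel_def)
qed

end
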